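(* Let $(S,r_S)$ and $(T,r_T)$ be solutions, let $(r_S,r_T,\alpha,\beta)$ be a matched product system of solutions, and let $\kappa:S\to S$ and $\omega:T\to T$ be maps such that $$\alpha_u\kappa=\kappa\alpha_u\qquad\text{and}\qquad \beta_a\omega=\omega\beta_a$$ for all $a\in S$ and $u\in T$. Then the following statements are equivalent: (i) $\kappa$ is a reflection for $(S,r_S)$ and $\omega$ is a reflection for $(T,r_T)$; (ii) $\kappa\times\omega$ is a reflection for the matched product solution $(S\times T,\ r_S\bowtie r_T)$.
   Context: A (set-theoretic) solution (of the Yang-Baxter equation) is a pair $(X,r)$ with $X$ a set and $r:X\times X\to X\times X$ a map satisfying $(r\times \mathrm{id}_X)(\mathrm{id}_X\times r)(r\times \mathrm{id}_X)=(\mathrm{id}_X\times r)(r\times \mathrm{id}_X)(\mathrm{id}_X\times r)$; write $r(x,y)=(\lambda_x(y),\rho_y(x))$. A reflection for $(X,r)$ is a map $\kappa:X\to X$ with $r(\mathrm{id}_X\times\kappa)r(\mathrm{id}_X\times\kappa)=(\mathrm{id}_X\times\kappa)r(\mathrm{id}_X\times\kappa)r$. Matched product systems: let $(S,r_S)$, $(T,r_T)$ be solutions, written $r_S(a,b)=(\lambda_a(b),\rho_b(a))$ for $a,b\in S$ and $r_T(u,v)=(\lambda_u(v),\rho_v(u))$ for $u,v\in T$, and let $\alpha:T\to\mathrm{Sym}(S)$, $\beta:S\to\mathrm{Sym}(T)$ be maps, with $\alpha_u:=\alpha(u)$, $\beta_a:=\beta(a)$. The quadruple $(r_S,r_T,\alpha,\beta)$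 is a matched product system of solutions if for all $a,b\in S$, $u,v\in T$: (s1) $\alpha_u\alpha_v=\alpha_{\lambda_u(v)}\alpha_{\rho_v(u)}$; (s2) $\beta_a\beta_b=\beta_{\lambda_a(b)}\beta_{\rho_b(a)}$; (s3) $\rho_{\alpha_u^{-1}(b)}\alpha^{-1}_{\beta_a(u)}(a)=\alpha^{-1}_{\beta_{\rho_b(a)}\beta_b^{-1}(u)}\rho_b(a)$; (s4) $\rho_{\beta_a^{-1}(v)}\beta^{-1}_{\alpha_u(a)}(u)=\beta^{-1}_{\alpha_{\rho_v(u)}\alpha_v^{-1}(a)}\rho_v(u)$; (s5) $\lambda_a\alpha_{\beta_a^{-1}(u)}=\alpha_u\lambda_{\alpha_u^{-1}(a)}$; (s6) $\lambda_u\beta_{\alpha_u^{-1}(a)}=\beta_a\lambda_{\beta_a^{-1}(u)}$. Then the matched product $r_S\bowtie r_T:(S\times T)^2\to(S\times T)^2$, $$(r_S\bowtie r_T)((a,u),(b,v)):=\Big(\big(\alpha_u\lambda_{\bar a}(b),\ \beta_a\lambda_{\bar u}(v)\big),\ \big(\alpha^{-1}_{\overline U}\rho_{\alpha_{\bar u}(b)}(a),\ \beta^{-1}_{\overline A}\rho_{\beta_{\bar a}(v)}(u)\big)\Big),$$ where $\bar a:=\alpha_u^{-1}(a)$, $\bar u:=\beta_a^{-1}(u)$, $A:=\alpha_u\lambda_{\bar a}(b)$, $U:=\beta_a\lambda_{\bar u}(v)$, $\overline A:=\alpha_U^{-1}(A)$, $\overline U:=\beta_A^{-1}(U)$, is known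 to be a solution on $S\times T$. *)

theory Defs
  imports Main
begin

text \<open>
  The underlying sets of solutions are rendered as types, hence are nonempty.
\<close>

definition r12 :: "('a \<times> 'a \<Rightarrow> 'a \<times> 'a) \<Rightarrow> 'a \<times> 'a \<times> 'a \<Rightarrow> 'a \<times> 'a \<times> 'a" where
  "r12 r = (\<lambda>(x, y, z). (fst (r (x, y)), snd (r (x, y)), z))"

definition r23 :: "('a \<times> 'a \<Rightarrow> 'a \<times> 'a) \<Rightarrow> 'a \<times> 'a \<times> 'a \<Rightarrow> 'a \<times> 'a \<times> 'a" where
  "r23 r = map_prod id r"

definition ybe_solution :: "('a \<times> 'a \<Rightarrow> 'a \<times> 'a) \<Rightarrow> bool" where
  "ybe_solution r \<longleftrightarrow> r12 r \<circ> r23 r \<circ> r12 r = r23 r \<circ> r12 r \<circ> r23 r"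

text \<open>
  The component maps of \<open>r(x, y) = (\<lambda>\<^sub>x(y), \<rho>\<^sub>y(x))\<close>. In both cases the subscript comes
  first: \<open>lam r x y\<close> is \<open>\<lambda>\<^sub>x(y)\<close> and \<open>rho r y x\<close> is \<open>\<rho>\<^sub>y(x)\<close>.
\<close>

definition lam :: "('a \<times> 'a \<Rightarrow> 'a \<times> 'a) \<Rightarrow> 'a \<Rightarrow> 'a \<Rightarrow> 'a" where
  "lam r x y = fst (r (x, y))"

definition rho :: "('a \<times> 'a \<Rightarrow> 'a \<times> 'a) \<Rightarrow> 'a \<Rightarrow> 'a \<Rightarrow> 'a" where
  "rho r y x = snd (r (x, y))"

definition reflection :: "('a \<times> 'a \<Rightarrow> 'a \<times> 'a) \<Rightarrow> ('a \<Rightarrow> 'a) \<Rightarrow> bool" where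
  "reflection r \<kappa> \<longleftrightarrow>
     r \<circ> map_prod id \<kappa> \<circ> r \<circ> map_prod id \<kappa> = map_prod id \<kappa> \<circ> r \<circ> map_prod id \<kappa> \<circ> r"

text \<open>
  The bijectivity conditions say that \<open>\<alpha>\<close> and \<open>\<beta>\<close> take values in the symmetric groups;
  the six remaining conditions are (s1)--(s6), in this order.
\<close>

definition matched_product_system ::
  "('a \<times> 'a \<Rightarrow> 'a \<times> 'a) \<Rightarrow> ('b \<times> 'b \<Rightarrow> 'b \<times> 'b) \<Rightarrow> ('b \<Rightarrow> 'a \<Rightarrow> 'a) \<Rightarrow> ('a \<Rightarrow> 'b \<Rightarrow> 'b) \<Rightarrow> bool"
where
  "matched_product_system rS rT \<alpha> \<beta> \<longleftrightarrow>
     ybe_solution rS \<and> ybe_solution rT \<and>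
     (\<forall>u. bij (\<alpha> u)) \<and> (\<forall>a. bij (\<beta> a)) \<and>
     (\<forall>u v. \<alpha> u \<circ> \<alpha> v = \<alpha> (lam rT u v) \<circ> \<alpha> (rho rT v u)) \<and>
     (\<forall>a b. \<beta> a \<circ> \<beta> b = \<beta> (lam rS a b) \<circ> \<beta> (rho rS b a)) \<and>
     (\<forall>a b u. rho rS (inv (\<alpha> u) b) (inv (\<alpha> (\<beta> a u)) a)
        = inv (\<alpha> (\<beta> (rho rS b a) (inv (\<beta> b) u))) (rho rS b a)) \<and>
     (\<forall>a u v. rho rT (inv (\<beta> a) v) (inv (\<beta> (\<alpha> u a)) u)
        = inv (\<beta> (\<alpha> (rho rT v u) (inv (\<alpha> v) a))) (rho rT v u)) \<and>
     (\<forall>a u. lam rS a \<circ> \<alpha> (inv (\<beta> a) u) = \<alpha> u \<circ> lam rS (inv (\<alpha> u) a)) \<and>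
     (\<forall>a u. lam rT u \<circ> \<beta> (inv (\<alpha> u) a) = \<beta> a \<circ> lam rT (inv (\<beta> a) u))"

text \<open>
  Here \<open>a'\<close>, \<open>u'\<close>, \<open>A'\<close>, \<open>U'\<close> are the elements usually written with an overline.
\<close>

definition matched_product ::
  "('a \<times> 'a \<Rightarrow> 'a \<times> 'a) \<Rightarrow> ('b \<times> 'b \<Rightarrow> 'b \<times> 'b) \<Rightarrow> ('b \<Rightarrow> 'a \<Rightarrow> 'a) \<Rightarrow> ('a \<Rightarrow> 'b \<Rightarrow> 'b)
     \<Rightarrow> ('a \<times> 'b) \<times> ('a \<times> 'b) \<Rightarrow> ('a \<times> 'b) \<times> ('a \<times> 'b)"
where
  "matched_product rS rT \<alpha> \<beta> = (\<lambda>((a, u), (b, v)).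
     let a' = inv (\<alpha> u) a;
         u' = inv (\<beta> a) u;
         A = \<alpha> u (lam rS a' b);
         U = \<beta> a (lam rT u' v);
         A' = inv (\<alpha> U) A;
         U' = inv (\<beta> A) U
     in ((A, U),
         (inv (\<alpha> U') (rho rS (\<alpha> u' b) a),
          inv (\<beta> A') (rho rT (\<beta> a' v) u))))"

end

theory Submission
  imports Defs
begin

text \<open>
  The matched product is a disguised direct product. By (s5) and (s6) its first output is
  \<open>(\<lambda>\<^sub>a(c), \<lambda>\<^sub>u(w))\<close> with \<open>c = \<alpha>\<^bsub>u'\<^esub>(b)\<close>, \<open>w = \<beta>\<^bsub>a'\<^esub>(v)\<close>, where \<open>u' = \<beta>\<^sub>a\<^sup>-\<^sup>1(u)\<close>,
  \<open>a' = \<alpha>\<^sub>u\<^sup>-\<^sup>1(a)\<close>; its second output is \<open>(\<rho>\<^sub>c(a), \<rho>\<^sub>w(u))\<close>, to which the same change of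
  coordinates, now taken at the first output, has been applied backwards. Hence the bijection
  \<open>J((a, u), (b, v)) = ((a, c), (u, w))\<close>, called \<open>untwist\<close> below, satisfies
  \<open>J \<circ> (r\<^sub>S \<bowtie> r\<^sub>T) = (r\<^sub>S \<times> r\<^sub>T) \<circ> J\<close> (lemma \<open>untwist_matched_product\<close>).

  Since \<open>\<kappa>\<close> and \<open>\<omega>\<close> commute with every \<open>\<alpha>\<^sub>u\<close> and \<open>\<beta>\<^sub>a\<close>, and \<open>J\<close> changes the second
  coordinates only by such maps, \<open>J\<close> also carries \<open>id \<times> (\<kappa> \<times> \<omega>)\<close> to
  \<open>(id \<times> \<kappa>) \<times> (id \<times> \<omega>)\<close> (lemma \<open>untwist_map_prod\<close>). The reflection equation for the
  matched product is therefore conjugate to an equation between product maps, and this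
  splits into the reflection equations for \<open>\<kappa>\<close> and \<open>\<omega>\<close>.
\<close>

definition untwist ::
  "('b \<Rightarrow> 'a \<Rightarrow> 'a) \<Rightarrow> ('a \<Rightarrow> 'b \<Rightarrow> 'b) \<Rightarrow> ('a \<times> 'b) \<times> ('a \<times> 'b) \<Rightarrow> ('a \<times> 'a) \<times> ('b \<times> 'b)"
where
  "untwist \<alpha> \<beta> = (\<lambda>((a, u), (b, v)).
     ((a, \<alpha> (inv (\<beta> a) u) b), (u, \<beta> (inv (\<alpha> u) a) v)))"

text \<open>
  The twisting permutations depend only on \<open>a\<close> and \<open>u\<close>, which the map leaves untouched.
\<close>

lemma bij_untwist:
  assumes "\<And>u. bij (\<alpha> u)" and "\<And>a. bij (\<beta> a)"
  shows "bij (untwist \<alpha> \<beta>)"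
proof (rule bijI)
  show "inj (untwist \<alpha> \<beta>)"
    using assms by (auto simp: inj_def untwist_def bij_def)
  show "surj (untwist \<alpha> \<beta>)"
  proof (rule surjI)
    fix z
    show "untwist \<alpha> \<beta> (case z of ((a, c), (u, w)) \<Rightarrow>
        ((a, u), (inv (\<alpha> (inv (\<beta> a) u)) c, inv (\<beta> (inv (\<alpha> u) a)) w))) = z"
      using assms by (auto simp: untwist_def bij_def surj_f_inv_f split: prod.splits)
  qed
qed

lemma untwist_matched_product:
  assumes "\<And>u. bij (\<alpha> u)" and "\<And>a. bij (\<beta> a)"
    and s5: "\<And>a u. lam rS a \<circ> \<alpha> (inv (\<beta> a) u) = \<alpha> u \<circ> lam rS (inv (\<alpha> u) a)"
    and s6: "\<And>a u. lam rT u \<circ> \<beta> (inv (\<alpha> u) a) = \<beta> a \<circ> lam rT (inv (\<beta> a) u)"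
  shows "untwist \<alpha> \<beta> \<circ> matched_product rS rT \<alpha> \<beta> = map_prod rS rT \<circ> untwist \<alpha> \<beta>"
proof -
  have A: "\<alpha> u (lam rS (inv (\<alpha> u) a) b) = lam rS a (\<alpha> (inv (\<beta> a) u) b)" for a u b
    using s5[of a u] by (metis comp_apply)
  have U: "\<beta> a (lam rT (inv (\<beta> a) u) v) = lam rT u (\<beta> (inv (\<alpha> u) a) v)" for a u v
    using s6[of u a] by (metis comp_apply)
  have "\<alpha> u (inv (\<alpha> u) a) = a" "\<beta> a (inv (\<beta> a) u) = u" for a u
    using assms(1,2) by (simp_all add: bij_def surj_f_inv_f)
  then show ?thesis
    by (auto simp: fun_eq_iff untwist_def matched_product_def Let_def rho_def
        A[unfolded lam_def] U[unfolded lam_def] lam_def)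
qed

lemma untwist_map_prod:
  assumes "\<And>u. \<alpha> u \<circ> \<kappa> = \<kappa> \<circ> \<alpha> u" and "\<And>a. \<beta> a \<circ> \<omega> = \<omega> \<circ> \<beta> a"
  shows "untwist \<alpha> \<beta> \<circ> map_prod id (map_prod \<kappa> \<omega>)
    = map_prod (map_prod id \<kappa>) (map_prod id \<omega>) \<circ> untwist \<alpha> \<beta>"
  using assms by (auto simp: fun_eq_iff untwist_def)

text \<open>
  Conjugation by a bijection preserves the relation \<open>fgfg = gfgf\<close>, of which the reflection
  equation is the case \<open>f = r\<close>, \<open>g = id \<times> \<kappa>\<close>.
\<close>

lemma conjugate_reflection_equation:
  assumes "bij J" and f: "J \<circ> f = f' \<circ> J" and g: "J \<circ> g = g' \<circ> J"
  shows "f \<circ> g \<circ> f \<circ> g = g \<circ> f \<circ> g \<circ> f \<longleftrightarrow> f' \<circ> g' \<circ> f' \<circ> g' = g' \<circ> f' \<circ> g' \<circ> f'"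
proof -
  have "J (f x) = f' (J x)" "J (g x) = g' (J x)" for x
    using f g by (metis comp_apply)+
  then have fgfg: "J \<circ> (f \<circ> g \<circ> f \<circ> g) = f' \<circ> g' \<circ> f' \<circ> g' \<circ> J"
    and gfgf: "J \<circ> (g \<circ> f \<circ> g \<circ> f) = g' \<circ> f' \<circ> g' \<circ> f' \<circ> J"
    by (simp_all add: fun_eq_iff)
  have "f \<circ> g \<circ> f \<circ> g = g \<circ> f \<circ> g \<circ> f
      \<longleftrightarrow> J \<circ> (f \<circ> g \<circ> f \<circ> g) = J \<circ> (g \<circ> f \<circ> g \<circ> f)"
    using bij_is_inj[OF \<open>bij J\<close>] by (auto simp: fun_eq_iff inj_eq)
  also have "\<dots> \<longleftrightarrow> f' \<circ> g' \<circ> f' \<circ> g' = g' \<circ> f' \<circ> g' \<circ> f'"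
    unfolding fgfg gfgf using bij_is_surj[OF \<open>bij J\<close>] by (metis surj_fun_eq)
  finally show ?thesis .
qed

text \<open>
  Each factor can be recovered from the product map because types are inhabited; this is
  where the splitting into two separate reflection equations would fail over empty sets.
\<close>

lemma map_prod_eq_iff: "map_prod f g = map_prod f' g' \<longleftrightarrow> f = f' \<and> g = g'"
  by (auto simp: fun_eq_iff)

theorem theorem5p3:
  fixes rS :: "'a \<times> 'a \<Rightarrow> 'a \<times> 'a"
    and rT :: "'b \<times> 'b \<Rightarrow> 'b \<times> 'b"
    and \<alpha> :: "'b \<Rightarrow> 'a \<Rightarrow> 'a"
    and \<beta> :: "'a \<Rightarrow> 'b \<Rightarrow> 'b"
    and \<kappa> :: "'a \<Rightarrow> 'a"
    and \<omega> :: "'b \<Rightarrow> 'b"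
  assumes "ybe_solution rS"
    and "ybe_solution rT"
    and "matched_product_system rS rT \<alpha> \<beta>"
    and "\<And>u. \<alpha> u \<circ> \<kappa> = \<kappa> \<circ> \<alpha> u"
    and "\<And>a. \<beta> a \<circ> \<omega> = \<omega> \<circ> \<beta> a"
  shows "(reflection rS \<kappa> \<and> reflection rT \<omega>)
     \<longleftrightarrow> reflection (matched_product rS rT \<alpha> \<beta>) (map_prod \<kappa> \<omega>)"
proof -
  let ?R = "map_prod rS rT"
  let ?K = "map_prod (map_prod id \<kappa>) (map_prod id \<omega>)"
  have bij: "\<And>u. bij (\<alpha> u)" "\<And>a. bij (\<beta> a)"
    and s5: "\<And>a u. lam rS a \<circ> \<alpha> (inv (\<beta> a) u) = \<alpha> u \<circ> lam rS (inv (\<alpha> u) a)"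
    and s6: "\<And>a u. lam rT u \<circ> \<beta> (inv (\<alpha> u) a) = \<beta> a \<circ> lam rT (inv (\<beta> a) u)"
    using assms(3) by (simp_all add: matched_product_system_def)
  have "reflection (matched_product rS rT \<alpha> \<beta>) (map_prod \<kappa> \<omega>)
      \<longleftrightarrow> ?R \<circ> ?K \<circ> ?R \<circ> ?K = ?K \<circ> ?R \<circ> ?K \<circ> ?R"
    unfolding reflection_def
    by (rule conjugate_reflection_equation[OF bij_untwist[OF bij]
          untwist_matched_product[OF bij s5 s6] untwist_map_prod[OF assms(4,5)]])
  also have "\<dots> \<longleftrightarrow> reflection rS \<kappa> \<and> reflection rT \<omega>"
    unfolding reflection_def map_prod.comp map_prod_eq_iff ..
  finally show ?thesis
    by blast
qed

end
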